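(* Let $p \ge 5$ be a prime and let $n := 2^{p-1}$. Let $\phi_k(n)$, for even $k$ with $0 \le k \le \lfloor n/2\rfloor$, be generated by the recurrence $$\frac{\phi_k(n)}{\phi_{k-2}(n)} = \frac{(2k-4)^2-n^2}{k(k-1)} \qquad (2 \le k \le \lfloor n/2 \rfloor,\ k \text{ even}),$$ where one can choose either of the following values to generate the sequence, from the starting term or from the last term: $$\phi_0(n) = 2, \qquad \phi_{\lfloor n/2\rfloor}(n) = 2^n$$ (both choices give the same sequence). Then $2^p-1$ is prime if and only if $$2n-1 \ \Big|\ \sum_{\substack{k=0\\ k \text{ even}}}^{\lfloor n/2\rfloor} \phi_k(n).$$
   Context: Note that $2n-1=2^p-1$, that $\lfloor n/2\rfloor = n/2$ is even, and that the $\phi_k(n)$ are integers; the divisibility is divisibility of integers. *)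

theory Defs
  imports Complex_Main "HOL-Computational_Algebra.Primes"
begin

text \<open>
  The values are taken in \<^typ>\<open>rat\<close>, so that the quotients are genuine ones and integrality
  is not built into the type. For \<open>2 \<le> k \<le> n div 2\<close> we have
  \<open>2 * k - 4 < n\<close>, hence the right-hand side is nonzero; since \<open>x / 0 = 0\<close>, the equation
  therefore forces \<open>\<phi> (k - 2) \<noteq> 0\<close>. The values of \<open>\<phi>\<close> at odd indices and
  beyond \<open>n div 2\<close> are irrelevant.
\<close>
definition phi_recurrence :: "nat \<Rightarrow> (nat \<Rightarrow> rat) \<Rightarrow> bool" where
  "phi_recurrence n \<phi> \<longleftrightarrow>
     (\<forall>k. even k \<and> 2 \<le> k \<and> k \<le> n div 2 \<longrightarrow>
        \<phi> k / \<phi> (k - 2) =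
          ((2 * of_nat k - 4)\<^sup>2 - (of_nat n)\<^sup>2) / (of_nat k * (of_nat k - 1)))"

text \<open>Solutions exist for every nonzero starting value, in particular for \<open>2\<close>.\<close>

lemma phi_recurrence_solvable:
  fixes c :: rat
  assumes "c \<noteq> 0"
  shows "\<exists>\<phi>. phi_recurrence n \<phi> \<and> \<phi> 0 = c"
proof -
  define r :: "nat \<Rightarrow> rat" where
    "r j = ((4 * of_nat j - 4)\<^sup>2 - (of_nat n)\<^sup>2) / (2 * of_nat j * (2 * of_nat j - 1))" for j
  define \<phi> where "\<phi> k = c * (\<Prod>j = 1..k div 2. r j)" for k
  have nz: "r j \<noteq> 0" if "1 \<le> j" "4 * j \<le> n" for j
  proof -
    have "(0::rat) \<le> 4 * of_nat j - 4" using that(1) by simp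
    moreover have "4 * of_nat j - 4 < (of_nat n :: rat)"
    proof -
      have "of_nat (4 * j) \<le> (of_nat n :: rat)" using that(2) by (rule of_nat_mono)
      then show ?thesis by simp
    qed
    ultimately have "(4 * of_nat j - 4)\<^sup>2 < (of_nat n :: rat)\<^sup>2"
      by (intro power_strict_mono) auto
    moreover have "(2 * of_nat j - 1 :: rat) > 0"
    proof -
      have "(1::rat) \<le> of_nat j" using that(1) by simp
      then show ?thesis by linarith
    qed
    ultimately show ?thesis using that(1) by (auto simp: r_def)
  qed
  have "\<phi> k / \<phi> (k - 2) =
          ((2 * of_nat k - 4)\<^sup>2 - (of_nat n)\<^sup>2) / (of_nat k * (of_nat k - 1))"
    if "even k" "2 \<le> k" "k \<le> n div 2" for k
  proof -
    from that(1,2) obtain i where i: "k = 2 * Suc i"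
      by (metis dvdE not0_implies_Suc mult_0_right not_numeral_le_zero)
    have "\<phi> (k - 2) \<noteq> 0"
      using assms nz that(3) by (auto simp: \<phi>_def i)
    moreover have "\<phi> k = \<phi> (k - 2) * r (Suc i)"
      by (simp add: \<phi>_def i)
    ultimately have "\<phi> k / \<phi> (k - 2) = r (Suc i)" by simp
    also have "\<dots> = ((2 * of_nat k - 4)\<^sup>2 - (of_nat n)\<^sup>2) / (of_nat k * (of_nat k - 1))"
      by (simp add: r_def i algebra_simps)
    finally show ?thesis .
  qed
  then show ?thesis
    by (intro exI[of _ \<phi>]) (auto simp: phi_recurrence_def \<phi>_def)
qed

end

theory Submission
  imports Defs "HOL-Number_Theory.Quadratic_Reciprocity"
begin

text \<open>
  Write \<open>n = 4 m\<close> with \<open>m = 2 ^ (p - 3)\<close>. The recurrence is solved by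
  \<open>\<phi> (2 j) = (- 16) ^ j (C (m + j, 2 j) + C (m + j - 1, 2 j))\<close>; up to a factor 2 these are the
  terms of \<open>T\<^sub>m (1 - 2 x\<^sup>2)\<close> at \<open>x = 2\<close>, where \<open>T\<^sub>m\<close> is the Chebyshev polynomial. Hence their sum
  is \<open>2 T\<^sub>m (7) = (7 + 4 \<surd>3) ^ m + (7 - 4 \<surd>3) ^ m\<close>, and \<open>7 + 4 \<surd>3 = (2 + \<surd>3)\<^sup>2\<close> turns this into
  the Lucas-Lehmer number \<open>(2 + \<surd>3) ^ (2 ^ (p - 2)) + (2 - \<surd>3) ^ (2 ^ (p - 2))\<close>. The criterion is then
  the Lucas-Lehmer test: if the divisibility holds, \<open>2 + \<surd>3\<close> has order \<open>2 ^ p\<close> modulo every prime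
  factor \<open>q\<close> of \<open>2 ^ p - 1\<close>, in a ring with \<open>q\<^sup>2\<close> elements, so \<open>q\<^sup>2 > 2 ^ p - 1\<close>; conversely, if \<open>q = 2 ^ p - 1\<close> is prime,
  the Frobenius map sends \<open>1 + \<surd>3\<close> to \<open>1 - \<surd>3\<close>, and \<open>(1 + \<surd>3)\<^sup>2 = 2 (2 + \<surd>3)\<close>.
\<close>

subsection \<open>The ring of integers extended by the square root of 3\<close>

text \<open>A set of reals rather than a new type: the arithmetic of \<open>sqrt 3\<close> comes
  from \<open>real\<close>, and being in the ring becomes a membership fact.\<close>

definition Z_sqrt3 :: "real set" where
  "Z_sqrt3 = {of_int a + of_int b * sqrt 3 | a b. True}"

lemma Z_sqrt3I: "of_int a + of_int b * sqrt 3 \<in> Z_sqrt3"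
  by (auto simp: Z_sqrt3_def)

lemma of_int_in_Z_sqrt3: "of_int a \<in> Z_sqrt3"
  using Z_sqrt3I[of a 0] by simp

lemma Z_sqrt3_add: "x \<in> Z_sqrt3 \<Longrightarrow> y \<in> Z_sqrt3 \<Longrightarrow> x + y \<in> Z_sqrt3"
proof -
  assume "x \<in> Z_sqrt3" "y \<in> Z_sqrt3"
  then obtain a b c d :: int where "x = of_int a + of_int b * sqrt 3" "y = of_int c + of_int d * sqrt 3"
    by (auto simp: Z_sqrt3_def)
  then have "x + y = of_int (a + c) + of_int (b + d) * sqrt 3"
    by (simp add: algebra_simps)
  then show ?thesis by (simp only: Z_sqrt3I)
qed

lemma Z_sqrt3_mult: "x \<in> Z_sqrt3 \<Longrightarrow> y \<in> Z_sqrt3 \<Longrightarrow> x * y \<in> Z_sqrt3"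
proof -
  assume "x \<in> Z_sqrt3" "y \<in> Z_sqrt3"
  then obtain a b c d :: int where "x = of_int a + of_int b * sqrt 3" "y = of_int c + of_int d * sqrt 3"
    by (auto simp: Z_sqrt3_def)
  then have "x * y = of_int (a * c + 3 * b * d) + of_int (a * d + b * c) * sqrt 3"
    by (simp add: algebra_simps)
  then show ?thesis by (simp only: Z_sqrt3I)
qed

lemma Z_sqrt3_power: "x \<in> Z_sqrt3 \<Longrightarrow> x ^ k \<in> Z_sqrt3"
  using of_int_in_Z_sqrt3[of 1] by (induction k) (auto intro: Z_sqrt3_mult)

lemma Z_sqrt3_sum: "(\<And>i. i \<in> I \<Longrightarrow> f i \<in> Z_sqrt3) \<Longrightarrow> sum f I \<in> Z_sqrt3"
  using of_int_in_Z_sqrt3[of 0] by (induction I rule: infinite_finite_induct) (auto intro: Z_sqrt3_add)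

text \<open>Irrationality of \<open>sqrt 3\<close>: in \<open>a\<^sup>2 = 3 * b\<^sup>2\<close> the
  exponent of 3 would be even on the left and odd on the right. It makes the coordinates of an
  element of \<open>Z_sqrt3\<close> unique.\<close>

lemma of_int_eq_times_sqrt3:
  fixes a b :: int
  assumes "of_int a = of_int b * sqrt 3"
  shows "b = 0"
proof (rule ccontr)
  assume b: "b \<noteq> 0"
  have "(of_int a)\<^sup>2 = (of_int b * sqrt 3)\<^sup>2"
    by (simp only: assms)
  then have "real_of_int (a\<^sup>2) = of_int (3 * b\<^sup>2)"
    by (simp add: power_mult_distrib)
  then have eq: "a\<^sup>2 = 3 * b\<^sup>2"
    by (simp only: of_int_eq_iff)
  with b have a: "a \<noteq> 0" by auto
  have 3: "prime_elem (3::int)" by simp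
  have "multiplicity 3 (a\<^sup>2) = 2 * multiplicity 3 a"
    using 3 a by (rule prime_elem_multiplicity_power_distrib)
  moreover have "multiplicity 3 (3 * b\<^sup>2) = Suc (2 * multiplicity 3 b)"
    using 3 b by (simp add: multiplicity_times_same prime_elem_multiplicity_power_distrib)
  ultimately have "2 * multiplicity 3 a = Suc (2 * multiplicity 3 b)"
    by (simp only: eq)
  then show False by presburger
qed

subsection \<open>Congruences modulo an integer\<close>

text \<open>Congruence modulo the ideal generated by \<open>q\<close>. The arguments are arbitrary
  reals, only the cofactor lies in the ring; membership of the arguments is asked for where products
  are formed.\<close>

definition cong_sqrt3 :: "int \<Rightarrow> real \<Rightarrow> real \<Rightarrow> bool" where
  "cong_sqrt3 q x y \<longleftrightarrow> (\<exists>z\<in>Z_sqrt3. x - y = of_int q * z)"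

lemma cong_sqrt3_refl: "cong_sqrt3 q x x"
  using of_int_in_Z_sqrt3[of 0] by (auto simp: cong_sqrt3_def)

lemma cong_sqrt3_trans [trans]:
  assumes "cong_sqrt3 q x y" "cong_sqrt3 q y z"
  shows "cong_sqrt3 q x z"
proof -
  obtain u v where "u \<in> Z_sqrt3" "v \<in> Z_sqrt3" "x - y = of_int q * u" "y - z = of_int q * v"
    using assms by (auto simp: cong_sqrt3_def)
  then show ?thesis
    unfolding cong_sqrt3_def by (intro bexI[of _ "u + v"] Z_sqrt3_add) (auto simp: algebra_simps)
qed

lemma cong_sqrt3_sym:
  assumes "cong_sqrt3 q x y"
  shows "cong_sqrt3 q y x"
proof -
  obtain u where "u \<in> Z_sqrt3" "x - y = of_int q * u"
    using assms by (auto simp: cong_sqrt3_def)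
  then show ?thesis
    unfolding cong_sqrt3_def
    by (intro bexI[of _ "of_int (-1) * u"] Z_sqrt3_mult of_int_in_Z_sqrt3) (auto simp: algebra_simps)
qed

lemma cong_sqrt3_add:
  assumes "cong_sqrt3 q x y" "cong_sqrt3 q x' y'"
  shows "cong_sqrt3 q (x + x') (y + y')"
proof -
  obtain u v where "u \<in> Z_sqrt3" "v \<in> Z_sqrt3" "x - y = of_int q * u" "x' - y' = of_int q * v"
    using assms by (auto simp: cong_sqrt3_def)
  then show ?thesis
    unfolding cong_sqrt3_def by (intro bexI[of _ "u + v"] Z_sqrt3_add) (auto simp: algebra_simps)
qed

lemma cong_sqrt3_mult:
  assumes "cong_sqrt3 q x y" "cong_sqrt3 q x' y'" "x' \<in> Z_sqrt3" "y \<in> Z_sqrt3"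
  shows "cong_sqrt3 q (x * x') (y * y')"
proof -
  obtain u v where uv: "u \<in> Z_sqrt3" "v \<in> Z_sqrt3" "x - y = of_int q * u" "x' - y' = of_int q * v"
    using assms by (auto simp: cong_sqrt3_def)
  have "x * x' - y * y' = (x - y) * x' + y * (x' - y')"
    by (simp add: algebra_simps)
  also have "\<dots> = of_int q * (u * x' + y * v)"
    by (simp add: uv algebra_simps)
  finally show ?thesis
    unfolding cong_sqrt3_def
    using uv assms by (intro bexI[of _ "u * x' + y * v"] Z_sqrt3_add Z_sqrt3_mult) auto
qed

lemma cong_sqrt3_mult_left:
  "cong_sqrt3 q x y \<Longrightarrow> c \<in> Z_sqrt3 \<Longrightarrow> cong_sqrt3 q (c * x) (c * y)"
  unfolding cong_sqrt3_def
  by (metis Z_sqrt3_mult mult.left_commute right_diff_distrib)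

lemma cong_sqrt3_power:
  assumes "cong_sqrt3 q x y" "x \<in> Z_sqrt3" "y \<in> Z_sqrt3"
  shows "cong_sqrt3 q (x ^ k) (y ^ k)"
  using assms
  by (induction k) (auto intro: cong_sqrt3_refl cong_sqrt3_mult Z_sqrt3_power)

text \<open>The ideal generated by \<open>q\<close> meets the integers only in the multiples of
  \<open>q\<close>, since the coefficient of \<open>sqrt 3\<close> must vanish. This carries results
  back from the ring to divisibility of integers.\<close>

lemma cong_sqrt3_of_int_iff: "cong_sqrt3 q (of_int a) (of_int b) \<longleftrightarrow> [a = b] (mod q)"
proof
  assume "cong_sqrt3 q (of_int a) (of_int b)"
  then obtain c d where "of_int a - of_int b = real_of_int q * (of_int c + of_int d * sqrt 3)"
    by (auto simp: cong_sqrt3_def Z_sqrt3_def)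
  then have *: "real_of_int (a - b - q * c) = of_int (q * d) * sqrt 3"
    by (simp add: algebra_simps)
  then have "q * d = 0"
    by (rule of_int_eq_times_sqrt3)
  with * have "real_of_int (a - b - q * c) = 0" by simp
  then have "a - b - q * c = 0" by (simp only: of_int_eq_0_iff)
  then show "[a = b] (mod q)"
    by (simp add: cong_iff_dvd_diff)
next
  assume "[a = b] (mod q)"
  then obtain c where "a - b = q * c"
    by (auto simp: cong_iff_dvd_diff)
  then have "real_of_int (a - b) = of_int (q * c)" by simp
  then show "cong_sqrt3 q (of_int a) (of_int b)"
    unfolding cong_sqrt3_def
    by (intro bexI[of _ "of_int c"] of_int_in_Z_sqrt3) simp
qed

text \<open>Pigeonhole principle: the quotient ring has \<open>q\<^sup>2\<close> elements.\<close>

lemma card_le_if_incongruent: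
  assumes "q > 0" "\<And>k. k < N \<Longrightarrow> f k \<in> Z_sqrt3"
    and incong: "\<And>k l. k < l \<Longrightarrow> l < N \<Longrightarrow> \<not> cong_sqrt3 (int q) (f k) (f l)"
  shows "N \<le> q\<^sup>2"
proof -
  have "\<forall>k. \<exists>a b. k < N \<longrightarrow> f k = of_int a + of_int b * sqrt 3"
    using assms(2) by (auto simp: Z_sqrt3_def)
  then obtain a b :: "nat \<Rightarrow> int" where ab: "\<And>k. k < N \<Longrightarrow> f k = of_int (a k) + of_int (b k) * sqrt 3"
    by metis
  define g where "g k = (a k mod int q, b k mod int q)" for k
  have "g k \<noteq> g l" if "k < l" "l < N" for k l
  proof
    assume "g k = g l"
    then have "int q dvd a k - a l" "int q dvd b k - b l"
      by (auto simp: g_def mod_eq_dvd_iff)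
    then obtain c d where "a k - a l = int q * c" "b k - b l = int q * d"
      by (auto elim!: dvdE)
    then have "a k = a l + int q * c" "b k = b l + int q * d" by auto
    then have "f k - f l = of_int (int q) * (of_int c + of_int d * sqrt 3)"
      using that by (simp add: ab algebra_simps)
    then have "cong_sqrt3 (int q) (f k) (f l)"
      unfolding cong_sqrt3_def using Z_sqrt3I by blast
    with incong that show False by blast
  qed
  then have "inj_on g {..<N}"
    by (intro linorder_inj_onI) auto
  moreover have "g ` {..<N} \<subseteq> {0..<int q} \<times> {0..<int q}"
    using \<open>q > 0\<close> by (auto simp: g_def)
  ultimately have "card {..<N} \<le> card ({0..<int q} \<times> {0..<int q})"
    by (intro card_inj_on_le) auto
  then show ?thesis by (simp add: power2_eq_square)
qed

text \<open>All inner binomial coefficients of a prime row are divisible by \<open>q\<close>; the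
  sum of their quotients is the cofactor in the ring.\<close>

lemma frobenius_one_plus_sqrt3:
  assumes "prime q"
  shows "cong_sqrt3 (int q) ((1 + sqrt 3) ^ q) (1 + sqrt 3 ^ q)"
proof -
  have q: "q > 1" using assms by (rule prime_gt_1_nat)
  have "(1 + sqrt 3) ^ q = (\<Sum>k\<le>q. of_nat (q choose k) * sqrt 3 ^ k)"
    using binomial_ring[of "sqrt 3" 1 q] by (simp add: add.commute)
  also have "{..q} = insert 0 (insert q {0<..<q})" by auto
  also have "(\<Sum>k\<in>\<dots>. of_nat (q choose k) * sqrt 3 ^ k)
      = 1 + sqrt 3 ^ q + (\<Sum>k\<in>{0<..<q}. of_nat (q choose k) * sqrt 3 ^ k)"
    using q by simp
  also have "(\<Sum>k\<in>{0<..<q}. of_nat (q choose k) * sqrt 3 ^ k)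
      = of_int (int q) * (\<Sum>k\<in>{0<..<q}. of_int (int ((q choose k) div q)) * sqrt 3 ^ k)"
    unfolding sum_distrib_left
  proof (rule sum.cong)
    fix k assume "k \<in> {0<..<q}"
    then have "q dvd (q choose k)"
      using assms q by (intro dvd_choose_prime) auto
    then have "q choose k = q * ((q choose k) div q)" by simp
    then have "real (q choose k) = real q * real ((q choose k) div q)"
      by (metis of_nat_mult)
    then show "real (q choose k) * sqrt 3 ^ k
      = of_int (int q) * (of_int (int ((q choose k) div q)) * sqrt 3 ^ k)" by simp
  qed simp
  finally show ?thesis
    unfolding cong_sqrt3_def using Z_sqrt3I[of 0 1]
    by (intro bexI[of _ "\<Sum>k\<in>{0<..<q}. of_int (int ((q choose k) div q)) * sqrt 3 ^ k"]
        Z_sqrt3_sum Z_sqrt3_mult of_int_in_Z_sqrt3 Z_sqrt3_power) auto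
qed

subsection \<open>The Lucas-Lehmer test\<close>

lemma two_plus_sqrt3_mem: "2 + sqrt 3 \<in> Z_sqrt3" "2 - sqrt 3 \<in> Z_sqrt3"
  using Z_sqrt3I[of 2 1] Z_sqrt3I[of 2 "-1"] by auto

text \<open>\<open>2 + sqrt 3\<close> has norm 1, so its conjugate is its inverse; multiplying by
  conjugate powers replaces division in congruences.\<close>

lemma two_plus_sqrt3_conj: "(2 + sqrt 3) ^ k * (2 - sqrt 3) ^ k = 1"
proof -
  have "(2 + sqrt 3) * (2 - sqrt 3) = 1" by (simp add: algebra_simps)
  then show ?thesis by (simp flip: power_mult_distrib)
qed

section \<open>Divisibility implies primality\<close>

lemma composite_nat_prime_factor:
  assumes "\<not> prime M" "M > (1::nat)"
  obtains q where "prime q" "q dvd M" "q\<^sup>2 \<le> M"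
proof -
  from assms obtain a where a: "a dvd M" "a \<noteq> 1" "a \<noteq> M"
    by (auto simp: prime_nat_iff)
  then obtain b where b: "M = a * b" by auto
  with a assms have b1: "b \<noteq> 1" by auto
  \<comment> \<open>The smaller of two complementary factors has square at most \<open>M\<close>,
    and so does each of its prime factors.\<close>
  define c where "c = min a b"
  have "c \<noteq> 1" using a b1 by (auto simp: c_def min_def)
  then obtain q where q: "prime q" "q dvd c" using prime_factor_nat by blast
  have "c > 0" using b assms by (auto simp: c_def intro!: Nat.gr0I)
  then have "q \<le> c" using q by (auto intro: dvd_imp_le)
  then have "q * q \<le> a * b" by (intro mult_mono) (auto simp: c_def)
  moreover have "c dvd M" by (auto simp: c_def b min_def)
  ultimately show ?thesis using q b that by (auto simp: power2_eq_square intro: dvd_trans)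
qed

text \<open>For composite \<open>M\<close> a prime factor with \<open>q\<^sup>2 \<le> M\<close>
  exists; the \<open>2 ^ p\<close> incongruent powers of \<open>2 + sqrt 3\<close> then force
  \<open>2 ^ p \<le> q\<^sup>2 \<le> M\<close>, which is absurd.\<close>

lemma lucas_lehmer_sufficient:
  fixes S :: int
  assumes "p \<ge> 2"
    and S: "of_int S = (2 + sqrt 3) ^ (2 ^ (p - 2)) + (2 - sqrt 3) ^ (2 ^ (p - 2))"
    and dvd: "2 ^ p - 1 dvd S"
  shows "prime (2 ^ p - 1 :: nat)"
proof (rule ccontr)
  define M where "M = (2 ^ p - 1 :: nat)"
  let ?\<alpha> = "2 + sqrt 3" and ?\<beta> = "2 - sqrt 3"
  assume "\<not> prime (2 ^ p - 1 :: nat)"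
  then have "\<not> prime M" by (simp add: M_def)
  moreover have "M > 1"
    using power_increasing[OF assms(1), of "2::nat"] by (simp add: M_def)
  ultimately obtain q where q: "prime q" "q dvd M" "q\<^sup>2 \<le> M"
    using composite_nat_prime_factor by blast
  have "odd M" using assms by (auto simp: M_def)
  with q have "odd q" by auto
  have intM: "int M = 2 ^ p - 1" by (simp add: M_def of_nat_diff)
  then have "int q dvd S" using q dvd by (metis dvd_trans int_dvd_int_iff)
  then have "cong_sqrt3 (int q) (of_int S) (of_int 0)"
    by (simp only: cong_sqrt3_of_int_iff cong_0_iff)
  \<comment> \<open>This factor turns the conjugate summand of \<open>S\<close> into 1, so that
    \<open>S\<close> being 0 modulo \<open>q\<close> says that
    \<open>?\<alpha> ^ (2 ^ (p - 1))\<close> is -1.\<close>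
  then have "cong_sqrt3 (int q) (?\<alpha> ^ (2 ^ (p - 2)) * of_int S) (?\<alpha> ^ (2 ^ (p - 2)) * of_int 0)"
    by (rule cong_sqrt3_mult_left) (intro Z_sqrt3_power two_plus_sqrt3_mem)
  also have "?\<alpha> ^ (2 ^ (p - 2)) * of_int S = ?\<alpha> ^ (2 * 2 ^ (p - 2)) + 1"
    by (simp add: S distrib_left two_plus_sqrt3_conj mult_2 power_add)
  also have "2 * 2 ^ (p - 2) = (2 ^ (p - 1) :: nat)"
    using assms(1) by (simp flip: power_Suc add: Suc_diff_le)
  finally have "cong_sqrt3 (int q) (?\<alpha> ^ (2 ^ (p - 1)) + 1 + - 1) (?\<alpha> ^ (2 ^ (p - 2)) * of_int 0 + - 1)"
    by (intro cong_sqrt3_add cong_sqrt3_refl)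
  then have minus1: "cong_sqrt3 (int q) (?\<alpha> ^ (2 ^ (p - 1))) (-1)" by simp
  have "2 ^ p \<le> q\<^sup>2"
  proof (rule card_le_if_incongruent)
    show "q > 0" using q by (simp add: prime_gt_0_nat)
    show "?\<alpha> ^ k \<in> Z_sqrt3" for k by (intro Z_sqrt3_power two_plus_sqrt3_mem)
    fix k l :: nat assume kl: "k < l" "l < 2 ^ p"
    show "\<not> cong_sqrt3 (int q) (?\<alpha> ^ k) (?\<alpha> ^ l)"
    proof
      assume "cong_sqrt3 (int q) (?\<alpha> ^ k) (?\<alpha> ^ l)"
      then have "cong_sqrt3 (int q) (?\<beta> ^ k * ?\<alpha> ^ k) (?\<beta> ^ k * ?\<alpha> ^ l)"
        by (rule cong_sqrt3_mult_left) (intro Z_sqrt3_power two_plus_sqrt3_mem)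
      moreover have "?\<beta> ^ k * ?\<alpha> ^ l = ?\<beta> ^ k * ?\<alpha> ^ k * ?\<alpha> ^ (l - k)"
        using kl by (simp flip: power_add add: mult.assoc)
      ultimately have one: "cong_sqrt3 (int q) (?\<alpha> ^ (l - k)) 1"
        using two_plus_sqrt3_conj[of k] by (simp add: mult.commute cong_sqrt3_sym)
      define d where "d = l - k"
      have d: "0 < d" "d < 2 ^ p" using kl by (auto simp: d_def)
      \<comment> \<open>Since \<open>d < 2 ^ p\<close>, the exponent \<open>e\<close> of 2 in
        \<open>d\<close> is below \<open>p\<close>. Raising \<open>?\<alpha> ^ d\<close> to the
        power \<open>2 ^ (p - 1 - e)\<close> gives an odd power of
        \<open>?\<alpha> ^ (2 ^ (p - 1))\<close>, hence -1; but \<open>?\<alpha> ^ d\<close> is 1,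
        so the odd prime \<open>q\<close> would divide 2.\<close>
      define e where "e = multiplicity 2 d"
      obtain c where c: "d = 2 ^ e * c" "odd c"
        using multiplicity_decompose'[of d 2] d by (auto simp: e_def)
      have "2 ^ e \<le> d" using c d by (intro dvd_imp_le) auto
      then have "(2::nat) ^ e < 2 ^ p" using d by linarith
      then have "e < p" by simp
      then have "d * 2 ^ (p - 1 - e) = 2 ^ (p - 1) * c"
        by (simp add: c mult_ac flip: power_add)
      then have pow: "(?\<alpha> ^ d) ^ (2 ^ (p - 1 - e)) = (?\<alpha> ^ (2 ^ (p - 1))) ^ c"
        by (simp flip: power_mult)
      have "cong_sqrt3 (int q) (1 ^ (2 ^ (p - 1 - e))) ((?\<alpha> ^ d) ^ (2 ^ (p - 1 - e)))"
        using one of_int_in_Z_sqrt3[of 1] unfolding d_def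
        by (intro cong_sqrt3_sym[of _ "(?\<alpha> ^ (l - k)) ^ (2 ^ (p - 1 - e))"] cong_sqrt3_power
            Z_sqrt3_power two_plus_sqrt3_mem) auto
      also note pow
      also have "cong_sqrt3 (int q) ((?\<alpha> ^ (2 ^ (p - 1))) ^ c) ((-1) ^ c)"
        using minus1 of_int_in_Z_sqrt3[of "-1"]
        by (intro cong_sqrt3_power Z_sqrt3_power two_plus_sqrt3_mem) auto
      finally have "cong_sqrt3 (int q) (of_int 1) (of_int (-1))"
        using \<open>odd c\<close> by simp
      then have "int q dvd 2"
        by (simp only: cong_sqrt3_of_int_iff cong_iff_dvd_diff) simp
      then have "q dvd 2" using int_dvd_int_iff[of q 2] by simp
      then have "q = 2" using q by (simp add: primes_dvd_imp_eq)
      with \<open>odd q\<close> show False by simp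
    qed
  qed
  with q(3) have "2 ^ p \<le> M" by linarith
  with \<open>M > 1\<close> show False by (simp add: M_def)
qed

section \<open>Primality implies divisibility\<close>

text \<open>Both 3 and \<open>q\<close> are 3 modulo 4, so reciprocity gives their two Legendre
  symbols opposite signs. For odd \<open>p\<close>, \<open>q\<close> is 1 modulo 3, a square; hence
  3 is a nonresidue modulo \<open>q\<close>, and Euler's criterion gives the power.\<close>

lemma mersenne_3_nonresidue:
  assumes "odd p" "p \<ge> 3" and q: "prime (2 ^ p - 1 :: nat)"
  shows "[3 ^ ((2 ^ p - 2) div 2) = - 1] (mod (2 ^ p - 1 :: int))"
proof -
  define q where "q = (2 ^ p - 1 :: nat)"
  have "prime q" using assms by (simp add: q_def)
  have intq: "int q = 2 ^ p - 1" by (simp add: q_def of_nat_diff)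
  have "(2::nat) ^ 3 \<le> 2 ^ p" using assms by (intro power_increasing) auto
  then have q7: "q \<ge> 7" by (simp add: q_def)
  have half: "(q - 1) div 2 = 2 ^ (p - 1) - 1"
    using assms by (cases p) (auto simp: q_def)
  have "odd ((q - 1) div 2)"
    unfolding half using assms by simp
  then have "Legendre (int 3) (int q) * Legendre (int q) (int 3) = - 1"
    using Quadratic_Reciprocity[of 3 q] q7 \<open>prime q\<close> by simp
  moreover have "Legendre (int q) 3 = 1"
  proof -
    obtain r where r: "p = Suc (2 * r)" using assms(1) by (metis oddE Suc_eq_plus1)
    have "[(4::int) ^ r = 1 ^ r] (mod 3)" by (intro cong_pow) (simp add: cong_def)
    then have "[2 * (4::int) ^ r - 1 = 2 * 1 ^ r - 1] (mod 3)"
      by (intro cong_diff cong_mult cong_refl)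
    then have *: "[int q = 1] (mod 3)" by (simp add: intq r power_mult)
    then have "QuadRes 3 (int q)"
      by (auto simp: QuadRes_def intro!: exI[of _ 1] dest: cong_sym)
    moreover have "\<not> [int q = 0] (mod 3)" using * by (auto simp: cong_def)
    ultimately show ?thesis by (simp add: Legendre_def)
  qed
  ultimately have "Legendre 3 (int q) = - 1" by simp
  moreover have "[Legendre 3 (int q) = 3 ^ ((q - 1) div 2)] (mod (int q))"
    using euler_criterion[of q 3] \<open>prime q\<close> q7 by simp
  moreover have "q - 1 = 2 ^ p - 2" by (simp add: q_def)
  ultimately show ?thesis
    by (simp add: intq cong_sym)
qed

text \<open>Evaluating \<open>?\<gamma> ^ (q + 1)\<close> in two ways, by Frobenius and through
  \<open>?\<gamma>\<^sup>2 = 2 * ?\<alpha>\<close>, yields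
  \<open>?\<alpha> ^ ((q + 1) div 2)\<close> up to powers of 2, which are controlled because 2 is a
  residue modulo \<open>q\<close>.\<close>

lemma lucas_lehmer_necessary:
  fixes S :: int
  assumes "odd p" "p \<ge> 3"
    and S: "of_int S = (2 + sqrt 3) ^ (2 ^ (p - 2)) + (2 - sqrt 3) ^ (2 ^ (p - 2))"
    and prime: "prime (2 ^ p - 1 :: nat)"
  shows "2 ^ p - 1 dvd S"
proof -
  define q where "q = (2 ^ p - 1 :: nat)"
  let ?\<alpha> = "2 + sqrt 3" and ?\<beta> = "2 - sqrt 3" and ?\<gamma> = "1 + sqrt 3"
  have "prime q" using assms by (simp add: q_def)
  have intq: "int q = 2 ^ p - 1" by (simp add: q_def of_nat_diff)
  obtain r where r: "p = Suc (2 * r)"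
    using assms(1) by (metis oddE Suc_eq_plus1)
  have "odd q" using assms by (auto simp: q_def)
  \<comment> \<open>\<open>h\<close> is \<open>(q - 1) div 2\<close>, the exponent in Euler's
    criterion.\<close>
  define h where "h = (2 ^ (2 * r) - 1 :: nat)"
  have q_h: "q = 2 * h + 1" "q + 1 = 2 * (h + 1)" "h + 1 = 2 ^ (2 * r)"
  proof -
    show *: "h + 1 = 2 ^ (2 * r)" by (simp add: h_def)
    have "q = 2 * (h + 1) - 1" unfolding * by (simp add: q_def r)
    then show "q = 2 * h + 1" "q + 1 = 2 * (h + 1)" by simp_all
  qed
  have mem: "?\<gamma> \<in> Z_sqrt3" "sqrt 3 \<in> Z_sqrt3"
    using Z_sqrt3I[of 1 1] Z_sqrt3I[of 0 1] by auto

  have "[(3::int) ^ h = - 1] (mod int q)"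
  proof -
    have "(2 ^ p - 2) div 2 = h" by (simp add: h_def r)
    then show ?thesis
      using mersenne_3_nonresidue[OF assms(1,2) prime] by (simp only: intq)
  qed
  then have 3: "cong_sqrt3 (int q) (of_int (3 ^ h)) (of_int (- 1))"
    by (simp only: cong_sqrt3_of_int_iff)
  \<comment> \<open>As \<open>q = 2 * h + 1\<close>, the power \<open>sqrt 3 ^ q\<close> is
    \<open>sqrt 3 * 3 ^ h\<close>, congruent to \<open>- sqrt 3\<close>: Frobenius acts on
    \<open>?\<gamma>\<close> as conjugation.\<close>
  have "cong_sqrt3 (int q) (sqrt 3 * of_int (3 ^ h)) (sqrt 3 * of_int (- 1))"
    by (intro cong_sqrt3_mult_left 3 mem)
  also have "sqrt 3 * of_int (3 ^ h) = sqrt 3 ^ q"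
    by (simp add: q_h power_mult)
  finally have "cong_sqrt3 (int q) (1 + sqrt 3 ^ q) (1 + sqrt 3 * of_int (- 1))"
    by (intro cong_sqrt3_add cong_sqrt3_refl)
  with frobenius_one_plus_sqrt3[OF \<open>prime q\<close>]
  have "cong_sqrt3 (int q) (?\<gamma> ^ q) (1 + sqrt 3 * of_int (- 1))"
    by (rule cong_sqrt3_trans)
  then have "cong_sqrt3 (int q) (?\<gamma> * ?\<gamma> ^ q) (?\<gamma> * (1 + sqrt 3 * of_int (- 1)))"
    by (rule cong_sqrt3_mult_left) (rule mem)
  moreover have "?\<gamma> * (1 + sqrt 3 * of_int (- 1)) = - 2"
    by (simp add: algebra_simps)
  moreover have "?\<gamma> * ?\<gamma> ^ q = (?\<gamma>\<^sup>2) ^ (h + 1)"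
    by (metis q_h(2) power_Suc power_mult Suc_eq_plus1)
  moreover have "?\<gamma>\<^sup>2 = 2 * ?\<alpha>"
    by (simp add: power2_eq_square algebra_simps)
  ultimately have A: "cong_sqrt3 (int q) (2 ^ (h + 1) * ?\<alpha> ^ (h + 1)) (- 2)"
    by (simp only: power_mult_distrib)

  have "Legendre 2 (int q) = 1"
  proof -
    \<comment> \<open>\<open>2 ^ p\<close> is 1 modulo \<open>q\<close> and
      \<open>p + 1 = 2 * (r + 1)\<close>, so \<open>2 ^ (r + 1)\<close> is a square root of
      2.\<close>
    have "(2 ^ (r + 1))\<^sup>2 - 2 = int q * 2"
      by (simp add: intq r power_even_eq power_mult_distrib)
    then have "[(2 ^ (r + 1))\<^sup>2 = 2] (mod int q)"
      unfolding cong_iff_dvd_diff by (metis dvd_triv_left)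
    then have "QuadRes (int q) 2" unfolding QuadRes_def by blast
    moreover have "\<not> [2 = 0] (mod int q)"
    proof
      assume "[2 = 0] (mod int q)"
      then have "q dvd 2" using int_dvd_int_iff[of q 2] by (simp add: cong_0_iff)
      then have "q = 2" using \<open>prime q\<close> by (simp add: primes_dvd_imp_eq)
      with \<open>odd q\<close> show False by simp
    qed
    ultimately show ?thesis by (simp add: Legendre_def)
  qed
  have "[1 = 2 ^ h] (mod int q)"
  proof -
    have "q > 2" using \<open>odd q\<close> prime_ge_2_nat[OF \<open>prime q\<close>] by (cases "q = 2") auto
    moreover have "(q - 1) div 2 = h" by (simp add: q_h(1))
    ultimately show ?thesis
      using euler_criterion[OF \<open>prime q\<close>, of 2] \<open>Legendre 2 (int q) = 1\<close> by simp
  qed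
  then have "[2 * 1 = 2 * 2 ^ h] (mod int q)" by (intro cong_mult cong_refl)
  then have "cong_sqrt3 (int q) (of_int (2 * 1)) (of_int (2 * 2 ^ h))"
    by (simp only: cong_sqrt3_of_int_iff)
  then have "cong_sqrt3 (int q) (?\<alpha> ^ (h + 1) * of_int (2 * 1)) (?\<alpha> ^ (h + 1) * of_int (2 * 2 ^ h))"
    by (rule cong_sqrt3_mult_left) (intro Z_sqrt3_power two_plus_sqrt3_mem)
  then have "cong_sqrt3 (int q) (2 * ?\<alpha> ^ (h + 1)) (2 ^ (h + 1) * ?\<alpha> ^ (h + 1))"
    by (simp add: mult_ac)
  then have B: "cong_sqrt3 (int q) (2 * ?\<alpha> ^ (h + 1)) (- 2)"
    using A by (rule cong_sqrt3_trans)

  let ?N = "2 ^ (p - 2) :: nat"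
  have N: "h + 1 = ?N + ?N"
    using r assms(2) unfolding q_h(3) by (cases r) simp_all
  \<comment> \<open>Since \<open>h + 1 = 2 * ?N\<close>, the factor \<open>?\<beta> ^ ?N\<close>
    cancels half of the power of \<open>?\<alpha>\<close> and leaves twice the two summands of
    \<open>S\<close>. The 2 is cancelled later, among the integers, where \<open>q\<close> is
    odd.\<close>
  have "cong_sqrt3 (int q) (?\<beta> ^ ?N * (2 * ?\<alpha> ^ (h + 1))) (?\<beta> ^ ?N * (- 2))"
    by (rule cong_sqrt3_mult_left[OF B]) (intro Z_sqrt3_power two_plus_sqrt3_mem)
  also have "?\<beta> ^ ?N * (2 * ?\<alpha> ^ (h + 1)) = 2 * ?\<alpha> ^ ?N * (?\<alpha> ^ ?N * ?\<beta> ^ ?N)"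
    by (simp only: N power_add mult_ac)
  finally have "cong_sqrt3 (int q) (2 * ?\<alpha> ^ ?N + 2 * ?\<beta> ^ ?N) (?\<beta> ^ ?N * (- 2) + 2 * ?\<beta> ^ ?N)"
    by (intro cong_sqrt3_add cong_sqrt3_refl) (simp add: two_plus_sqrt3_conj)
  moreover have "2 * ?\<alpha> ^ ?N + 2 * ?\<beta> ^ ?N = of_int (2 * S)"
    by (simp add: S)
  ultimately have "cong_sqrt3 (int q) (of_int (2 * S)) (of_int 0)"
    by simp
  then have "int q dvd 2 * S"
    by (simp only: cong_sqrt3_of_int_iff cong_0_iff)
  moreover have "coprime (int q) 2"
    using \<open>odd q\<close> by simp
  ultimately have "int q dvd S"
    by (simp add: coprime_dvd_mult_right_iff)
  then show ?thesis by (simp add: intq)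
qed

theorem lucas_lehmer:
  fixes S :: int
  assumes "odd p" "p \<ge> 3"
    and "of_int S = (2 + sqrt 3) ^ (2 ^ (p - 2)) + (2 - sqrt 3) ^ (2 ^ (p - 2))"
  shows "prime (2 ^ p - 1 :: nat) \<longleftrightarrow> 2 ^ p - 1 dvd S"
  using lucas_lehmer_sufficient[of p S] lucas_lehmer_necessary[of p S] assms by auto

subsection \<open>Solution of the recurrence\<close>

text \<open>The Morgan-Voyce polynomial \<open>b_m\<close> at \<open>y\<close>;
  \<open>odd_binomial_sum y m\<close> is its companion \<open>B_(m-1)\<close>, and 0 for
  \<open>m = 0\<close>.\<close>

definition even_binomial_sum :: "'a::comm_ring_1 \<Rightarrow> nat \<Rightarrow> 'a" where
  "even_binomial_sum y m = (\<Sum>j\<le>m. of_nat ((m + j) choose (2 * j)) * y ^ j)"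

definition odd_binomial_sum :: "'a::comm_ring_1 \<Rightarrow> nat \<Rightarrow> 'a" where
  "odd_binomial_sum y m = (\<Sum>j\<le>m. of_nat ((m + j) choose (2 * j + 1)) * y ^ j)"

lemma odd_binomial_sum_Suc:
  "odd_binomial_sum y (Suc m) = odd_binomial_sum y m + even_binomial_sum y m"
proof -
  have "odd_binomial_sum y (Suc m) = (\<Sum>j\<le>m. of_nat ((Suc m + j) choose (2 * j + 1)) * y ^ j)"
    by (simp add: odd_binomial_sum_def binomial_eq_0)
  also have "\<dots> = (\<Sum>j\<le>m. of_nat ((m + j) choose (2 * j + 1)) * y ^ j
      + of_nat ((m + j) choose (2 * j)) * y ^ j)"
    by (intro sum.cong) (auto simp: algebra_simps)
  finally show ?thesis
    by (simp add: sum.distrib odd_binomial_sum_def even_binomial_sum_def)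
qed

text \<open>Pascal's rule after shifting \<open>j\<close> by one; the shift releases the factor
  \<open>y\<close> in front of the odd sum.\<close>

lemma even_binomial_sum_Suc:
  "even_binomial_sum y (Suc m) = even_binomial_sum y m + y * odd_binomial_sum y (Suc m)"
proof -
  have "even_binomial_sum y (Suc m)
      = 1 + (\<Sum>j\<le>m. of_nat ((Suc m + Suc j) choose (2 * Suc j)) * y ^ Suc j)"
    unfolding even_binomial_sum_def by (subst sum.atMost_Suc_shift) simp
  also have "(\<Sum>j\<le>m. of_nat ((Suc m + Suc j) choose (2 * Suc j)) * y ^ Suc j)
      = (\<Sum>j\<le>m. of_nat ((m + Suc j) choose (2 * Suc j)) * y ^ Suc j
         + y * (of_nat ((Suc m + j) choose (2 * j + 1)) * y ^ j))"
    by (intro sum.cong) (auto simp: algebra_simps)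
  also have "1 + \<dots> = (1 + (\<Sum>j\<le>m. of_nat ((m + Suc j) choose (2 * Suc j)) * y ^ Suc j))
      + y * (\<Sum>j\<le>m. of_nat ((Suc m + j) choose (2 * j + 1)) * y ^ j)"
    by (simp add: sum.distrib sum_distrib_left add.assoc)
  also have "1 + (\<Sum>j\<le>m. of_nat ((m + Suc j) choose (2 * Suc j)) * y ^ Suc j)
      = (\<Sum>j\<le>Suc m. of_nat ((m + j) choose (2 * j)) * y ^ j)"
    by (subst sum.atMost_Suc_shift) simp
  also have "\<dots> = even_binomial_sum y m"
    by (simp add: even_binomial_sum_def binomial_eq_0)
  also have "(\<Sum>j\<le>m. of_nat ((Suc m + j) choose (2 * j + 1)) * y ^ j) = odd_binomial_sum y (Suc m)"
    by (simp add: odd_binomial_sum_def binomial_eq_0)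
  finally show ?thesis .
qed

text \<open>Eliminating the odd sums leaves a second-order recurrence with characteristic roots
  \<open>z\<close> and \<open>w\<close>, also satisfied by the right-hand side; two initial values
  settle it.\<close>

lemma even_binomial_sum_add:
  fixes z w :: "'a::comm_ring_1"
  assumes zw: "z * w = 1"
  defines "y \<equiv> z + w - 2"
  shows "even_binomial_sum y (Suc m) + even_binomial_sum y m = z ^ Suc m + w ^ Suc m"
proof (induction m rule: less_induct)
  case (less m)
  let ?A = "even_binomial_sum y" and ?B = "odd_binomial_sum y"
  have 0: "?A 0 = 1" "?B 0 = 0"
    by (simp_all add: even_binomial_sum_def odd_binomial_sum_def)
  have rec: "?A (Suc (Suc k)) = (z + w) * ?A (Suc k) - ?A k" for k
  proof -
    have "?A (Suc (Suc k)) = ?A (Suc k) + y * ?A (Suc k) + y * ?B (Suc k)"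
      by (subst even_binomial_sum_Suc, subst odd_binomial_sum_Suc) (simp add: algebra_simps)
    also have "y * ?B (Suc k) = ?A (Suc k) - ?A k"
      by (simp add: even_binomial_sum_Suc)
    finally show ?thesis by (simp add: y_def algebra_simps)
  qed
  have 1: "?A (Suc 0) = z + w - 1"
    by (simp add: even_binomial_sum_Suc odd_binomial_sum_Suc 0) (simp add: y_def)
  consider "m = 0" | "m = 1" | k where "m = Suc (Suc k)"
    by (metis One_nat_def not0_implies_Suc)
  then show ?case
  proof cases
    case 1
    then show ?thesis by (simp add: \<open>?A (Suc 0) = z + w - 1\<close> 0)
  next
    case 2
    have "(z + w) * (z + w - 1) - 1 + (z + w - 1) = z * z + w * w + 2 * (z * w) - 2"
      by (simp add: algebra_simps)
    then show ?thesis using 2 zw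
      by (simp add: rec 1 0 power2_eq_square)
  next
    case 3
    have "?A (Suc m) + ?A m = (z + w) * (?A (Suc (Suc k)) + ?A (Suc k)) - (?A (Suc k) + ?A k)"
      by (simp add: 3 rec algebra_simps)
    also have "\<dots> = (z + w) * (z ^ Suc (Suc k) + w ^ Suc (Suc k)) - (z ^ Suc k + w ^ Suc k)"
      using less[of k] less[of "Suc k"] 3 by simp
    also have "\<dots> = z ^ Suc m + w ^ Suc m + (z * w - 1) * (z ^ Suc k + w ^ Suc k)"
      by (simp add: 3 algebra_simps)
    finally show ?thesis by (simp add: zw)
  qed
qed

section \<open>Closed form of the sequence\<close>

text \<open>The value at index \<open>2 * j\<close> for \<open>n = 4 * m\<close> and starting value
  2. Two binomials replace the quotient \<open>2 * m / (m + j)\<close> times one binomial, so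
  integrality is built in.\<close>

definition phi_coeff :: "nat \<Rightarrow> nat \<Rightarrow> int" where
  "phi_coeff m j = (- 16) ^ j * int (((m + j) choose (2 * j)) + ((m + j - 1) choose (2 * j)))"

lemma phi_coeff_0: "m > 0 \<Longrightarrow> phi_coeff m 0 = 2"
  by (simp add: phi_coeff_def)

lemma phi_coeff_self: "m > 0 \<Longrightarrow> phi_coeff m m = (- 16) ^ m"
  by (simp add: phi_coeff_def binomial_eq_0 flip: mult_2)

text \<open>Absorption expresses the second binomial by the first, with ratio \<open>m - j\<close>
  to \<open>m + j\<close>.\<close>

lemma phi_coeff_eq:
  assumes "j \<le> m" "m > 0"
  shows "int (m + j) * phi_coeff m j = (- 16) ^ j * (2 * int m * int ((m + j) choose (2 * j)))"
proof -
  have "(m + j) * ((m + j - 1) choose (2 * j)) = (m - j) * ((m + j) choose (2 * j))"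
    using binomial_absorb_comp[of "m + j" "2 * j"] assms by simp
  then have "int (m + j) * int ((m + j - 1) choose (2 * j)) = int (m - j) * int ((m + j) choose (2 * j))"
    by (metis of_nat_mult)
  then have "int (m + j) * int (((m + j) choose (2 * j)) + ((m + j - 1) choose (2 * j)))
     = 2 * int m * int ((m + j) choose (2 * j))"
    using assms by (simp add: of_nat_diff algebra_simps)
  then show ?thesis
    unfolding phi_coeff_def by (metis mult.left_commute)
qed

text \<open>The recurrence at \<open>k = 2 * (j + 1)\<close>, \<open>n = 4 * m\<close>, with
  denominators cleared. The two binomials are linked through the intermediate
  \<open>?e\<close>.\<close>

lemma phi_coeff_Suc:
  assumes "Suc j \<le> m"
  shows "2 * (int j + 1) * (2 * int j + 1) * phi_coeff m (Suc j)
    = 16 * ((int j)\<^sup>2 - (int m)\<^sup>2) * phi_coeff m j"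
proof -
  let ?c = "int ((m + j) choose (2 * j))" and ?d = "int ((m + Suc j) choose (2 * Suc j))"
    and ?e = "int ((m + j) choose Suc (2 * j))"
  have 1: "int (Suc (2 * j + 1)) * ?d = int (Suc (m + j)) * ?e"
  proof -
    have "Suc (2 * j + 1) * ((m + Suc j) choose (2 * Suc j)) = Suc (m + j) * ((m + j) choose Suc (2 * j))"
      using Suc_times_binomial_eq[of "m + j" "2 * j + 1"] by (simp only: mult.commute) simp
    then show ?thesis by (metis of_nat_mult)
  qed
  have "Suc (2 * j) * ((m + j) choose Suc (2 * j)) = (m + j - 2 * j) * ((m + j) choose (2 * j))"
    using binomial_absorption[of "2 * j" "m + j"] binomial_absorb_comp[of "m + j" "2 * j"] by simp
  then have "int (Suc (2 * j)) * ?e = int (m - j) * ?c"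
    using assms by (metis of_nat_mult add_diff_cancel_right mult_2)
  then have 2: "int (Suc (2 * j)) * ?e = (int m - int j) * ?c"
    using assms by (simp add: of_nat_diff)
  have 3: "2 * (int j + 1) * (2 * int j + 1) * ?d = (int m + int j + 1) * (int m - int j) * ?c"
  proof -
    have "2 * (int j + 1) * (2 * int j + 1) * ?d = int (Suc (2 * j)) * (int (Suc (2 * j + 1)) * ?d)"
      by (simp add: mult_ac add_ac del: binomial_Suc_Suc mult_Suc_right)
    also have "\<dots> = int (Suc (m + j)) * (int (Suc (2 * j)) * ?e)"
      unfolding 1 by (simp only: mult_ac)
    also have "\<dots> = (int m + int j + 1) * (int m - int j) * ?c"
      unfolding 2 by (simp add: algebra_simps)
    finally show ?thesis .
  qed
  \<comment> \<open>The nonzero factor \<open>m + j + 1\<close> makes \<open>phi_coeff_eq\<close>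
    applicable to \<open>Suc j\<close>; it is cancelled at the end.\<close>
  have "int (m + Suc j) * (2 * (int j + 1) * (2 * int j + 1) * phi_coeff m (Suc j))
     = 2 * (int j + 1) * (2 * int j + 1) * (int (m + Suc j) * phi_coeff m (Suc j))"
    by (simp only: mult_ac)
  also have "\<dots> = 2 * (int j + 1) * (2 * int j + 1) * ((- 16) ^ Suc j * (2 * int m * ?d))"
    using phi_coeff_eq[of "Suc j" m] assms by simp
  also have "\<dots> = (- 16) ^ Suc j * 2 * int m * (2 * (int j + 1) * (2 * int j + 1) * ?d)"
    by (simp only: mult_ac)
  also have "\<dots> = (int m + int j + 1) * (16 * (int j - int m) * ((- 16) ^ j * (2 * int m * ?c)))"
    unfolding 3 by (simp add: algebra_simps)
  also have "(- 16) ^ j * (2 * int m * ?c) = int (m + j) * phi_coeff m j"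
    using phi_coeff_eq[of j m] assms by simp
  also have "(int m + int j + 1) * (16 * (int j - int m) * (int (m + j) * phi_coeff m j))
    = int (m + Suc j) * (16 * ((int j)\<^sup>2 - (int m)\<^sup>2) * phi_coeff m j)"
    by (simp add: algebra_simps power2_eq_square)
  finally show ?thesis
    by (subst (asm) mult_cancel_left) simp
qed

text \<open>The two binomials of each term yield the even sums for \<open>m\<close> and
  \<open>m - 1\<close> at \<open>y = - 16\<close>, which is \<open>z + w - 2\<close>.\<close>

lemma sum_phi_coeff:
  fixes z w :: "'a::comm_ring_1"
  assumes "m > 0" "z * w = 1" "z + w = - 14"
  shows "of_int (\<Sum>j\<le>m. phi_coeff m j) = z ^ m + w ^ m"
proof -
  obtain k where k: "m = Suc k" using assms(1) by (cases m) auto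
  have "of_int (\<Sum>j\<le>m. phi_coeff m j)
     = (\<Sum>j\<le>m. of_nat ((m + j) choose (2 * j)) * (- 16 :: 'a) ^ j)
       + (\<Sum>j\<le>m. of_nat ((k + j) choose (2 * j)) * (- 16) ^ j)"
    by (simp add: phi_coeff_def k algebra_simps flip: sum.distrib)
  also have "\<dots> = even_binomial_sum (- 16) (Suc k) + even_binomial_sum (- 16) k"
    by (simp add: even_binomial_sum_def k binomial_eq_0)
  also have "\<dots> = z ^ m + w ^ m"
    using even_binomial_sum_add[OF assms(2), of k] assms(3) by (simp add: k)
  finally show ?thesis .
qed

text \<open>Keeping \<open>\<phi> 0\<close> as a parameter serves both choices of prescribed value;
  the 2 on the left is the starting value of \<open>phi_coeff\<close>.\<close>

lemma phi_recurrence_eq: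
  assumes rec: "phi_recurrence (4 * m) \<phi>" and "m > 0" "j \<le> m"
  shows "2 * \<phi> (2 * j) = \<phi> 0 * of_int (phi_coeff m j)"
  using \<open>j \<le> m\<close>
proof (induction j)
  case 0
  then show ?case using \<open>m > 0\<close> by (simp add: phi_coeff_0)
next
  case (Suc j)
  let ?r = "((2 * of_nat (2 * Suc j) - 4)\<^sup>2 - (of_nat (4 * m))\<^sup>2)
      / (of_nat (2 * Suc j) * (of_nat (2 * Suc j) - 1)) :: rat"
  have eq: "\<phi> (2 * Suc j) / \<phi> (2 * j) = ?r"
    using rec[unfolded phi_recurrence_def, rule_format, of "2 * Suc j"] Suc.prems by simp
  have r: "?r = 16 * ((of_nat j)\<^sup>2 - (of_nat m)\<^sup>2) / (2 * (of_nat j + 1) * (2 * of_nat j + 1))"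
    by (simp add: algebra_simps power2_eq_square)
  \<comment> \<open>Because \<open>x / 0 = 0\<close>, the recurrence can be multiplied out only once
    \<open>\<phi> (2 * j)\<close> is known to be nonzero; this follows from \<open>?r\<close> being
    nonzero, as \<open>j < m\<close>.\<close>
  have "(of_nat j)\<^sup>2 < (of_nat m :: rat)\<^sup>2"
    using Suc.prems by (intro power_strict_mono) auto
  moreover have pos: "2 * (of_nat j + 1) * (2 * of_nat j + 1) > (0::rat)"
    by (intro mult_pos_pos) (auto intro: add_nonneg_pos)
  ultimately have "?r \<noteq> 0" unfolding r by (metis divide_eq_0_iff less_irrefl mult_eq_0_iff
      right_minus_eq zero_neq_numeral)
  with eq have "\<phi> (2 * j) \<noteq> 0" by auto
  with eq have "\<phi> (2 * Suc j) = ?r * \<phi> (2 * j)" by (metis nonzero_eq_divide_eq)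
  then have "(2 * (of_nat j + 1) * (2 * of_nat j + 1)) * (2 * \<phi> (2 * Suc j))
      = 16 * ((of_nat j)\<^sup>2 - (of_nat m)\<^sup>2) * (2 * \<phi> (2 * j))"
    using pos unfolding r by (simp add: less_imp_neq[symmetric])
  also have "\<dots> = \<phi> 0 * of_int (16 * ((int j)\<^sup>2 - (int m)\<^sup>2) * phi_coeff m j)"
    using Suc by simp
  also have "\<dots> = (2 * (of_nat j + 1) * (2 * of_nat j + 1)) * (\<phi> 0 * of_int (phi_coeff m (Suc j)))"
    using arg_cong[OF phi_coeff_Suc[OF Suc.prems], of "of_int :: int \<Rightarrow> rat"] by simp
  finally show ?case
    using pos by (subst (asm) mult_cancel_left) linarith
qed

theorem theorem5:
  fixes p n :: nat and \<phi> :: "nat \<Rightarrow> rat"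
  assumes "prime p" and "p \<ge> 5"
    and "n = 2 ^ (p - 1)"
    and "phi_recurrence n \<phi>"
    and "\<phi> 0 = 2 \<or> \<phi> (n div 2) = 2 ^ n"
  shows "\<phi> 0 = 2 \<and> \<phi> (n div 2) = 2 ^ n \<and>
    (\<forall>k. even k \<and> k \<le> n div 2 \<longrightarrow> \<phi> k \<in> \<int>) \<and>
    (prime (2 ^ p - 1 :: int) \<longleftrightarrow>
      (\<exists>s::int. of_int s = (\<Sum>k | even k \<and> k \<le> n div 2. \<phi> k) \<and> 2 * int n - 1 dvd s))"
proof -
  define m :: nat where "m = 2 ^ (p - 3)"
  have n: "n = 4 * m"
  proof -
    have "p - 1 = 2 + (p - 3)" using assms(2) by simp
    then show ?thesis by (simp only: assms(3) m_def power_add) simp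
  qed
  have m: "m > 0" "even m"
    using assms(2) by (auto simp: m_def)
  have "odd p"
    using assms(1,2) prime_odd_nat[of p] by simp
  have phi: "2 * \<phi> (2 * j) = \<phi> 0 * of_int (phi_coeff m j)" if "j \<le> m" for j
    using assms(4) m(1) that unfolding n by (rule phi_recurrence_eq)
  \<comment> \<open>As \<open>m\<close> is even, \<open>(- 16) ^ m\<close> is \<open>16 ^ m\<close>.
    Thus the prescribed last value forces the same \<open>\<phi> 0\<close> as the prescribed first
    one.\<close>
  have last: "phi_coeff m m = 2 ^ n"
    using m power_mult[of "2::int" 4 m] by (simp add: phi_coeff_self n)
  from assms(5) have phi0: "\<phi> 0 = 2"
  proof
    assume "\<phi> (n div 2) = 2 ^ n"
    then have "2 * 2 ^ n = \<phi> 0 * 2 ^ n"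
      using phi[of m] by (simp add: last n)
    then show ?thesis by simp
  qed
  have coeff: "\<phi> (2 * j) = of_int (phi_coeff m j)" if "j \<le> m" for j
    using phi[OF that] phi0 by simp
  have indices: "{k. even k \<and> k \<le> n div 2} = (*) 2 ` {..m}"
    by (auto simp: n elim!: evenE)
  define S where "S = (\<Sum>j\<le>m. phi_coeff m j)"
  have sum: "(\<Sum>k | even k \<and> k \<le> n div 2. \<phi> k) = of_int S"
    unfolding indices S_def by (subst sum.reindex) (auto simp: inj_on_def coeff)
  \<comment> \<open>The numbers with sum -14 and product 1 are \<open>- 7 - 4 * sqrt 3\<close> and
    \<open>- 7 + 4 * sqrt 3\<close>, the negated squares of \<open>2 + sqrt 3\<close> and
    \<open>2 - sqrt 3\<close>; the even exponent \<open>m\<close> removes the signs.\<close>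
  have "real_of_int S = (- ((2 + sqrt 3)\<^sup>2)) ^ m + (- ((2 - sqrt 3)\<^sup>2)) ^ m"
    unfolding S_def
  proof (rule sum_phi_coeff[OF m(1)])
    show "- ((2 + sqrt 3)\<^sup>2) * - ((2 - sqrt 3)\<^sup>2) = 1"
      using two_plus_sqrt3_conj[of 2] by simp
    show "- ((2 + sqrt 3)\<^sup>2) + - ((2 - sqrt 3)\<^sup>2) = - 14"
      by (simp add: power2_eq_square algebra_simps)
  qed
  also have "\<dots> = (2 + sqrt 3) ^ (2 * m) + (2 - sqrt 3) ^ (2 * m)"
    using m(2) by (simp add: power_mult)
  also have "2 * m = 2 ^ (p - 2)"
  proof -
    have "p - 2 = Suc (p - 3)" using assms(2) by simp
    then show ?thesis by (simp only: m_def power_Suc)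
  qed
  finally have "prime (2 ^ p - 1 :: nat) \<longleftrightarrow> 2 ^ p - 1 dvd S"
    using \<open>odd p\<close> assms(2) by (intro lucas_lehmer) auto
  moreover have "prime (2 ^ p - 1 :: int) \<longleftrightarrow> prime (2 ^ p - 1 :: nat)"
    using prime_nat_int_transfer[of "2 ^ p - 1"] by (simp add: of_nat_diff)
  moreover have "2 * int n - 1 = 2 ^ p - 1"
    using assms(2) by (cases p) (auto simp: assms(3))
  moreover have "\<phi> k \<in> \<int>" if "even k" "k \<le> n div 2" for k
    using that coeff[of "k div 2"] by (auto simp: n)
  moreover have "\<phi> (n div 2) = 2 ^ n"
    using coeff[of m] by (simp add: last n)
  ultimately show ?thesis
    by (simp add: phi0 sum)
qed

end
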